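(* Let $n_1,n_2$ be even positive integers and let $0<\theta_1^\ast<\theta_2^\ast<\pi$ be such that $\theta_1^\ast$ is an integer multiple of $\frac{2\pi}{n_1}$ and $\theta_2^\ast$ is an integer multiple of $\frac{2\pi}{n_2}$. Let $B_1,B_2,\Gamma_1,\Gamma_2$ be the discs and arcs determined by these angles, let $N:=\frac12 n_1-1$, and let $L_{1,N}:C_0(\Gamma_1)\to C(\overline\Gamma_2)$ be the operator $$L_{1,N}v:=\big(\Delta_1^{-1}I_N^1(0,v)\big)|_{\overline\Gamma_2}.$$ Then, with the matrices $C,S$, the vectors $\mathbf c(\theta,r),\mathbf s(\theta,r)$ and the projection $Q$ defined in the context, $$\|L_{1,N}\|_\infty:=\sup_{v\in C_0(\Gamma_1),\,v\neq 0}\frac{\|L_{1,N}v\|_{L^\infty(\overline\Gamma_2)}}{\|v\|_{L^\infty(\Gamma_1)}}\;\le\;\max_{(\theta,r)\in\overline\Gamma_2}\big\|Q\big(C\,\mathbf c(\theta,r)+S\,\mathbf s(\theta,r)\big)\big\|_1 .$$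
   Context: Geometry: $B_1$ is the open unit disc in $\mathbb R^2$ centred at the origin and $B_2$ is the open disc with centre $(m,0)$ and radius $R$, where $R=\frac{\sin\theta_1^\ast}{\sin\theta_2^\ast}$, $m=\cos\theta_1^\ast-\frac{\sin\theta_1^\ast}{\tan\theta_2^\ast}$ if $\theta_2^\ast\neq\frac\pi2$, and $m=\cos\theta_1^\ast$ if $\theta_2^\ast=\frac\pi2$. The circles intersect exactly in $(\cos\theta_1^\ast,\pm\sin\theta_1^\ast)=(m,0)+R(\cos\theta_2^\ast,\pm\sin\theta_2^\ast)$. Put $\Gamma_1:=\partial B_1\cap B_2$ (polar angles in $(-\theta_1^\ast,\theta_1^\ast)$) and $\Gamma_2:=\partial B_2\cap B_1$. $(\theta,r)\in\overline\Gamma_2$ means that $r(\cos\theta,\sin\theta)\in\overline\Gamma_2$ (polar coordinates centred at the origin, $0\le r\le 1$). $C_0(\Gamma_1)$ is the space of continuous functions on $\overline\Gamma_1$ vanishing at the two endpoints of $\Gamma_1$; for $v\in C_0(\Gamma_1)$, $(0,v)\in C(\partial B_1)$ is its extension by $0$. Interpolation: let $x_\ell:=\ell\frac{2\pi}{n_1}$ and $X_\ell:=(\cos x_\ell,\sin x_\ell)$, $\ell=0,\dots,n_1-1$. For $f\in C(\partial B_1)$, $I_N^1f$ is the unique element of $\mathrm{span}\{1,\cos\theta,\dots,\cos(N\theta),\sin\theta,\dots,\sin(N\theta),\cos(\tfrac12n_1\theta)\}$ (functions of the polar angle $\theta$ on $\partial B_1$) with $(I_N^1f)(X_\ell)=f(X_\ell)$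 for all $\ell=0,\dots,n_1-1$. The operator $\Delta_1^{-1}$ is harmonic extension from $\partial B_1$ to $\overline B_1$, i.e. the linear map sending $\cos(n\theta)$ to $r^n\cos(n\theta)$ and $\sin(n\theta)$ to $r^n\sin(n\theta)$ on such trigonometric polynomials. Matrices and vectors: $C\in\mathbb R^{n_1\times(\frac12n_1+1)}$, $C_{ij}=\frac{2}{n_1}\cos((j-1)x_{i-1})$; $S\in\mathbb R^{n_1\times(\frac12n_1-1)}$, $S_{ij}=\frac{2}{n_1}\sin(j x_{i-1})$; $$\mathbf c(\theta,r)=\big(\tfrac12,\ r\cos\theta,\ r^2\cos(2\theta),\dots,\ r^{\frac12n_1-1}\cos((\tfrac12n_1-1)\theta),\ \tfrac12 r^{\frac12n_1}\cos(\tfrac12n_1\theta)\big)^T,$$ $$\mathbf s(\theta,r)=\big(r\sin\theta,\ r^2\sin(2\theta),\dots,\ r^{\frac12n_1-1}\sin((\tfrac12n_1-1)\theta)\big)^T.$$ $Q:\mathbb R^{n_1}\to\mathbb R^{n_1}$ is the coordinate projection with $(Q\mathbf w)_j=\mathbf w_j$ if $X_{j-1}$ lies in the (relatively open) arc $\Gamma_1$, and $(Q\mathbf w)_j=0$ otherwise, $1\le j\le n_1$. $\|\cdot\|_1$ is the $\ell^1$ vector norm. *)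

theory Defs
  imports "HOL-Analysis.Analysis" "Jordan_Normal_Form.Matrix"
begin

section \<open>Geometry\<close>

definition polar :: "real \<Rightarrow> real \<Rightarrow> real \<times> real" where
  "polar \<theta> r = (r * cos \<theta>, r * sin \<theta>)"

definition disc1 :: "(real \<times> real) set" where
  "disc1 = ball (0, 0) 1"

definition radius2 :: "real \<Rightarrow> real \<Rightarrow> real" where
  "radius2 \<theta>1 \<theta>2 = sin \<theta>1 / sin \<theta>2"

definition centre2 :: "real \<Rightarrow> real \<Rightarrow> real" where
  "centre2 \<theta>1 \<theta>2 =
     (if \<theta>2 \<noteq> pi / 2 then cos \<theta>1 - sin \<theta>1 / tan \<theta>2 else cos \<theta>1)"

definition disc2 :: "real \<Rightarrow> real \<Rightarrow> (real \<times> real) set" where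
  "disc2 \<theta>1 \<theta>2 = ball (centre2 \<theta>1 \<theta>2, 0) (radius2 \<theta>1 \<theta>2)"

definition arc1 :: "real \<Rightarrow> real \<Rightarrow> (real \<times> real) set" where
  "arc1 \<theta>1 \<theta>2 = frontier disc1 \<inter> disc2 \<theta>1 \<theta>2"

definition arc2 :: "real \<Rightarrow> real \<Rightarrow> (real \<times> real) set" where
  "arc2 \<theta>1 \<theta>2 = frontier (disc2 \<theta>1 \<theta>2) \<inter> disc1"

text \<open>Polar coordinates \<open>(\<theta>, r)\<close> of the points of the closed second arc.  The angle is not
  normalised; everything evaluated on this set is \<open>2\<pi>\<close>-periodic in it.\<close>

definition arc2_polar :: "real \<Rightarrow> real \<Rightarrow> (real \<times> real) set" where
  "arc2_polar \<theta>1 \<theta>2 =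
     {(\<theta>, r). 0 \<le> r \<and> r \<le> 1 \<and> polar \<theta> r \<in> closure (arc2 \<theta>1 \<theta>2)}"


section \<open>Function spaces and norms\<close>

text \<open>The endpoints of the first arc are the points with polar angles \<open>\<theta>1\<close> and \<open>-\<theta>1\<close>.
  Only the values on the closed arc matter; a member is the zero element iff it vanishes there.\<close>

definition C0_arc1 :: "real \<Rightarrow> real \<Rightarrow> (real \<times> real \<Rightarrow> real) set" where
  "C0_arc1 \<theta>1 \<theta>2 =
     {v. continuous_on (closure (arc1 \<theta>1 \<theta>2)) v \<and> v (polar \<theta>1 1) = 0 \<and> v (polar (- \<theta>1) 1) = 0}"

definition zero_extension :: "'a set \<Rightarrow> ('a \<Rightarrow> real) \<Rightarrow> 'a \<Rightarrow> real" where
  "zero_extension A v = (\<lambda>x. if x \<in> A then v x else 0)"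

text \<open>Supremum norm, which for continuous functions on an arc is the \<open>L\<^sup>\<infinity>\<close> norm.
  It is extended-real valued so that the supremum is meaningful without a boundedness proof.\<close>

definition sup_norm :: "'a set \<Rightarrow> ('a \<Rightarrow> real) \<Rightarrow> ereal" where
  "sup_norm A f = (SUP x\<in>A. ereal \<bar>f x\<bar>)"


section \<open>Interpolation and harmonic extension\<close>

definition node_angle :: "nat \<Rightarrow> nat \<Rightarrow> real" where
  "node_angle n l = real l * (2 * pi / real n)"

definition node :: "nat \<Rightarrow> nat \<Rightarrow> real \<times> real" where
  "node n l = polar (node_angle n l) 1"

text \<open>The span of \<open>1, cos \<theta>, \<dots>, cos (N \<theta>), sin \<theta>, \<dots>, sin (N \<theta>), cos (n/2 \<theta>)\<close>, as a space of
  functions on the unit circle.  Extensionality makes such functions equal as soon as they agree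
  on the circle, which is needed for the definite descriptions below.\<close>

definition trig_space :: "nat \<Rightarrow> nat \<Rightarrow> (real \<times> real \<Rightarrow> real) set" where
  "trig_space N n =
     {p \<in> extensional (frontier disc1).
        \<exists>a b c. \<forall>\<theta>. p (polar \<theta> 1) =
          (\<Sum>k=0..N. a k * cos (real k * \<theta>)) + (\<Sum>k=1..N. b k * sin (real k * \<theta>))
          + c * cos (real n / 2 * \<theta>)}"

definition trig_interpolant ::
    "nat \<Rightarrow> nat \<Rightarrow> (real \<times> real \<Rightarrow> real) \<Rightarrow> real \<times> real \<Rightarrow> real" where
  "trig_interpolant N n f =
     (THE p. p \<in> trig_space N n \<and> (\<forall>l<n. p (node n l) = f (node n l)))"

text \<open>Harmonic extension of trigonometric polynomials (of any degree \<open>K\<close>) from the unit circle to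
  the closed unit disc: the linear map sending \<open>cos (k \<theta>)\<close> to \<open>r\<^sup>k cos (k \<theta>)\<close> and
  \<open>sin (k \<theta>)\<close> to \<open>r\<^sup>k sin (k \<theta>)\<close>.\<close>

definition harmonic_extension ::
    "(real \<times> real \<Rightarrow> real) \<Rightarrow> real \<times> real \<Rightarrow> real" where
  "harmonic_extension p =
     (THE u. u \<in> extensional (closure disc1) \<and>
        (\<exists>(K::nat) a b.
          (\<forall>\<theta>. p (polar \<theta> 1) =
             (\<Sum>k=0..K. a k * cos (real k * \<theta>)) + (\<Sum>k=1..K. b k * sin (real k * \<theta>))) \<and>
          (\<forall>\<theta> r. 0 \<le> r \<and> r \<le> 1 \<longrightarrow> u (polar \<theta> r) =
             (\<Sum>k=0..K. a k * (r ^ k * cos (real k * \<theta>)))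
             + (\<Sum>k=1..K. b k * (r ^ k * sin (real k * \<theta>))))))"

definition L_op ::
    "nat \<Rightarrow> nat \<Rightarrow> real \<Rightarrow> real \<Rightarrow> (real \<times> real \<Rightarrow> real) \<Rightarrow> real \<times> real \<Rightarrow> real" where
  "L_op N n \<theta>1 \<theta>2 v =
     restrict
       (harmonic_extension (trig_interpolant N n (zero_extension (arc1 \<theta>1 \<theta>2) v)))
       (closure (arc2 \<theta>1 \<theta>2))"

definition L_op_norm :: "nat \<Rightarrow> nat \<Rightarrow> real \<Rightarrow> real \<Rightarrow> ereal" where
  "L_op_norm N n \<theta>1 \<theta>2 =
     (SUP v \<in> {v \<in> C0_arc1 \<theta>1 \<theta>2. \<exists>x \<in> closure (arc1 \<theta>1 \<theta>2). v x \<noteq> 0}.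
        sup_norm (closure (arc2 \<theta>1 \<theta>2)) (L_op N n \<theta>1 \<theta>2 v) / sup_norm (arc1 \<theta>1 \<theta>2) v)"


section \<open>Matrices and vectors\<close>

text \<open>Rows, columns and components are numbered from 0.\<close>

definition C_mat :: "nat \<Rightarrow> real Matrix.mat" where
  "C_mat n = Matrix.mat n (n div 2 + 1) (\<lambda>(i, j). 2 / real n * cos (real j * node_angle n i))"

definition S_mat :: "nat \<Rightarrow> real Matrix.mat" where
  "S_mat n = Matrix.mat n (n div 2 - 1) (\<lambda>(i, j). 2 / real n * sin (real (j + 1) * node_angle n i))"

definition c_vec :: "nat \<Rightarrow> real \<Rightarrow> real \<Rightarrow> real Matrix.vec" where
  "c_vec n \<theta> r = Matrix.vec (n div 2 + 1) (\<lambda>j.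
     if j = 0 then 1 / 2
     else if j = n div 2 then 1 / 2 * r ^ j * cos (real j * \<theta>)
     else r ^ j * cos (real j * \<theta>))"

definition s_vec :: "nat \<Rightarrow> real \<Rightarrow> real \<Rightarrow> real Matrix.vec" where
  "s_vec n \<theta> r = Matrix.vec (n div 2 - 1) (\<lambda>j. r ^ (j + 1) * sin (real (j + 1) * \<theta>))"

definition Q_proj :: "nat \<Rightarrow> real \<Rightarrow> real \<Rightarrow> real Matrix.vec \<Rightarrow> real Matrix.vec" where
  "Q_proj n \<theta>1 \<theta>2 w =
     Matrix.vec n (\<lambda>j. if node n j \<in> arc1 \<theta>1 \<theta>2 then vec_index w j else 0)"

definition norm_l1 :: "real Matrix.vec \<Rightarrow> real" where
  "norm_l1 w = (\<Sum>j<dim_vec w. \<bar>vec_index w j\<bar>)"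

definition Q_bound :: "nat \<Rightarrow> real \<Rightarrow> real \<Rightarrow> real \<Rightarrow> real \<Rightarrow> real" where
  "Q_bound n \<theta>1 \<theta>2 \<theta> r =
     norm_l1 (Q_proj n \<theta>1 \<theta>2 (C_mat n *\<^sub>v c_vec n \<theta> r + S_mat n *\<^sub>v s_vec n \<theta> r))"

end

(* Discrete orthogonality of the cosines and sines at the n equispaced nodes shows that the
   entries of C c + S s are the harmonic extensions of the Lagrange basis functions of the
   interpolation space.  Hence L v is a combination of them with coefficients v(X_j), the nodes
   outside the first arc dropping out, and the triangle inequality bounds it by the l1 norm times
   sup |v|.  The bound depends on (theta, r) only through the point of the compact closed second
   arc, continuously, so its maximum is attained. *)

theory Submission
  imports Defs
begin

section \<open>Discrete orthogonality\<close>

text \<open>This is a geometric sum over powers of \<open>w\<close> = exp(2 pi i d / n):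
  \<open>w ^ n = 1\<close> always, and \<open>w = 1\<close> exactly when n divides d. The frequency
  d is an integer so that differences of frequencies are covered.\<close>

lemma sum_cis_nodes:
  assumes "n > 0"
  shows "(\<Sum>l<n. cis (of_int d * node_angle n l)) = (if int n dvd d then of_nat n else 0)"
proof -
  define w where "w = cis (of_int d * (2 * pi / real n))"
  have w_pow: "w ^ l = cis (of_int d * node_angle n l)" for l
    unfolding w_def node_angle_def by (simp add: Complex.DeMoivre mult_ac)
  have wn: "w ^ n = 1"
    unfolding w_def Complex.DeMoivre using assms cis_multiple_2pi[of "of_int d"] by (simp add: mult_ac)
  have sum: "(\<Sum>l<n. cis (of_int d * node_angle n l)) = (\<Sum>l<n. w ^ l)"
    by (simp add: w_pow)
  show ?thesis
  proof (cases "int n dvd d")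
    case True
    then obtain e where "d = int n * e" by blast
    then have "w = 1"
      unfolding w_def using assms cis_multiple_2pi[of "of_int e"] by (simp add: mult_ac)
    then show ?thesis using True sum by simp
  next
    case False
    have "w \<noteq> 1"
    proof
      assume "w = 1"
      then have "cos (of_int d * (2 * pi / real n)) = 1"
        unfolding w_def by (metis Re_complex_of_real cis.sel(1) of_real_1)
      then obtain e :: int where "of_int d * (2 * pi / real n) = of_int e * 2 * pi"
        using cos_one_2pi_int by auto
      then have "real_of_int d = of_int (e * int n)"
        using assms by (simp add: field_simps)
      then have "d = e * int n" by (simp only: of_int_eq_iff)
      then show False using False by simp
    qed
    then show ?thesis using False sum wn by (simp add: geometric_sum)
  qed
qed

lemma sum_cos_nodes:
  assumes "n > 0"
  shows "(\<Sum>l<n. cos (of_int d * node_angle n l)) = (if int n dvd d then real n else 0)"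
  using arg_cong[OF sum_cis_nodes[OF assms, of d], of Re] by (simp split: if_splits)

lemma sum_sin_nodes:
  assumes "n > 0"
  shows "(\<Sum>l<n. sin (of_int d * node_angle n l)) = 0"
  using arg_cong[OF sum_cis_nodes[OF assms, of d], of Im] by (simp split: if_splits)

lemma not_dvd_of_abs_less:
  fixes d :: int
  assumes "\<bar>d\<bar> < int n" and "d \<noteq> 0"
  shows "\<not> int n dvd d"
  using assms dvd_imp_le_int by force

text \<open>The product formula leaves the frequencies k - m and k + m. The first lies in [-h, h],
  so 2h divides it only at 0. The second lies in [0, 2h], where both ends are multiples of 2h; this
  doubles the value at frequencies 0 and h.\<close>

lemma sum_cos_cos_nodes:
  assumes "k \<le> h" "m \<le> h" "h > 0"
  shows "(\<Sum>l<2*h. cos (real k * node_angle (2*h) l) * cos (real m * node_angle (2*h) l)) =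
           (if k = m then if k = 0 \<or> k = h then 2 * real h else real h else 0)"
proof -
  let ?x = "node_angle (2*h)"
  have "cos (real k * t) * cos (real m * t) =
          (cos (of_int (int k - int m) * t) + cos (of_int (int k + int m) * t)) / 2" for t
    by (simp add: left_diff_distrib distrib_right cos_diff cos_add)
  then have "(\<Sum>l<2*h. cos (real k * ?x l) * cos (real m * ?x l)) =
      ((\<Sum>l<2*h. cos (of_int (int k - int m) * ?x l)) +
       (\<Sum>l<2*h. cos (of_int (int k + int m) * ?x l))) / 2"
    by (simp only: sum.distrib flip: sum_divide_distrib)
  also have "\<dots> = ((if int (2*h) dvd int k - int m then real (2*h) else 0) +
       (if int (2*h) dvd int k + int m then real (2*h) else 0)) / 2"
    using assms by (simp only: sum_cos_nodes zero_less_mult_iff zero_less_numeral simp_thms)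
  also have "int (2*h) dvd int k - int m \<longleftrightarrow> k = m"
    using not_dvd_of_abs_less[of "int k - int m" "2*h"] assms by (cases "k = m") auto
  also have "int (2*h) dvd int k + int m \<longleftrightarrow> k = m \<and> (k = 0 \<or> k = h)"
  proof (cases "k = h \<and> m = h \<or> k = 0 \<and> m = 0")
    case False
    then show ?thesis
      using not_dvd_of_abs_less[of "int k + int m" "2*h"] assms by auto
  qed auto
  finally show ?thesis by auto
qed

lemma sum_sin_sin_nodes:
  assumes "0 < k" "k < h" "0 < m" "m \<le> h"
  shows "(\<Sum>l<2*h. sin (real m * node_angle (2*h) l) * sin (real k * node_angle (2*h) l)) =
           (if m = k then real h else 0)"
proof -
  let ?x = "node_angle (2*h)"
  have "sin (real m * t) * sin (real k * t) =
          (cos (of_int (int m - int k) * t) - cos (of_int (int m + int k) * t)) / 2" for t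
    by (simp add: left_diff_distrib distrib_right cos_diff cos_add)
  then have "(\<Sum>l<2*h. sin (real m * ?x l) * sin (real k * ?x l)) =
      ((\<Sum>l<2*h. cos (of_int (int m - int k) * ?x l)) -
       (\<Sum>l<2*h. cos (of_int (int m + int k) * ?x l))) / 2"
    by (simp only: sum_subtractf flip: sum_divide_distrib)
  also have "\<dots> = ((if int (2*h) dvd int m - int k then real (2*h) else 0) -
       (if int (2*h) dvd int m + int k then real (2*h) else 0)) / 2"
    using assms by (subst (1 2) sum_cos_nodes) auto
  also have "int (2*h) dvd int m - int k \<longleftrightarrow> m = k"
    using not_dvd_of_abs_less[of "int m - int k" "2*h"] assms by (cases "m = k") auto
  also have "int (2*h) dvd int m + int k \<longleftrightarrow> False"
    using not_dvd_of_abs_less[of "int m + int k" "2*h"] assms by auto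
  finally show ?thesis by auto
qed

text \<open>The product formula leaves only sines, whose sums over the nodes vanish at every integer
  frequency.\<close>

lemma sum_sin_cos_nodes:
  assumes "n > 0"
  shows "(\<Sum>l<n. sin (real k * node_angle n l) * cos (real m * node_angle n l)) = 0"
proof -
  have "sin (real k * t) * cos (real m * t) =
          (sin (of_int (int k + int m) * t) + sin (of_int (int k - int m) * t)) / 2" for t
    by (simp add: left_diff_distrib distrib_right sin_diff sin_add)
  then have "(\<Sum>l<n. sin (real k * node_angle n l) * cos (real m * node_angle n l)) =
      ((\<Sum>l<n. sin (of_int (int k + int m) * node_angle n l)) +
       (\<Sum>l<n. sin (of_int (int k - int m) * node_angle n l))) / 2"
    by (simp only: sum.distrib flip: sum_divide_distrib)
  then show ?thesis by (simp only: sum_sin_nodes[OF assms]) simp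
qed

text \<open>The coefficient \<open>b h\<close> is invisible: \<open>sin (h \<theta>)\<close> vanishes at every node.\<close>

lemma trig_poly_coeffs_zero:
  assumes "h > 0"
    and zero: "\<And>l. l < 2*h \<Longrightarrow>
      (\<Sum>k=0..h. a k * cos (real k * node_angle (2*h) l)) +
      (\<Sum>k=1..h. b k * sin (real k * node_angle (2*h) l)) = 0"
  shows "m \<le> h \<Longrightarrow> a m = 0" and "0 < m \<Longrightarrow> m < h \<Longrightarrow> b m = 0"
proof -
  let ?x = "node_angle (2*h)"
  \<comment> \<open>Test the vanishing grid values against an arbitrary weight g; taking g to be a
    cosine or a sine then isolates a single coefficient.\<close>
  have swap: "0 = (\<Sum>k=0..h. a k * (\<Sum>l<2*h. cos (real k * ?x l) * g l)) +
      (\<Sum>k=1..h. b k * (\<Sum>l<2*h. sin (real k * ?x l) * g l))" for g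
  proof -
    have "0 = (\<Sum>l<2*h. ((\<Sum>k=0..h. a k * cos (real k * ?x l)) +
        (\<Sum>k=1..h. b k * sin (real k * ?x l))) * g l)"
      using zero by simp
    also have "\<dots> = (\<Sum>l<2*h. \<Sum>k=0..h. a k * (cos (real k * ?x l) * g l)) +
        (\<Sum>l<2*h. \<Sum>k=1..h. b k * (sin (real k * ?x l) * g l))"
      by (simp add: sum.distrib sum_distrib_right distrib_right mult.assoc)
    also have "\<dots> = (\<Sum>k=0..h. a k * (\<Sum>l<2*h. cos (real k * ?x l) * g l)) +
        (\<Sum>k=1..h. b k * (\<Sum>l<2*h. sin (real k * ?x l) * g l))"
      by (subst (1 2) sum.swap) (simp add: sum_distrib_left)
    finally show ?thesis .
  qed
  {
    assume m: "m \<le> h"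
    have "0 = (\<Sum>k=0..h. a k * (\<Sum>l<2*h. cos (real k * ?x l) * cos (real m * ?x l)))"
      using swap[of "\<lambda>l. cos (real m * ?x l)"] \<open>h > 0\<close> by (simp add: sum_sin_cos_nodes)
    also have "\<dots> = (\<Sum>k=0..h. a k * (if k = m then if k = 0 \<or> k = h then 2 * real h else real h else 0))"
      using m \<open>h > 0\<close> by (intro sum.cong refl) (simp add: sum_cos_cos_nodes)
    also have "\<dots> = a m * (if m = 0 \<or> m = h then 2 * real h else real h)"
      using m by (simp add: if_distrib[of "(*) _"] cong: if_cong)
    finally show "a m = 0" using \<open>h > 0\<close> by (simp split: if_splits)
  }
  {
    assume m: "0 < m" "m < h"
    have cos0: "(\<Sum>l<2*h. cos (real k * ?x l) * sin (real m * ?x l)) = 0" for k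
      using sum_sin_cos_nodes[of "2*h" m k] \<open>h > 0\<close> by (simp add: mult.commute)
    have "0 = (\<Sum>k=1..h. b k * (\<Sum>l<2*h. sin (real k * ?x l) * sin (real m * ?x l)))"
      using swap[of "\<lambda>l. sin (real m * ?x l)"] by (simp add: cos0)
    also have "\<dots> = (\<Sum>k=1..h. b k * (if k = m then real h else 0))"
      using m by (intro sum.cong) (auto simp: sum_sin_sin_nodes)
    also have "\<dots> = b m * real h"
      using m by (simp add: if_distrib[of "(*) _"] cong: if_cong)
    finally show "b m = 0" using \<open>h > 0\<close> by simp
  }
qed


section \<open>Harmonic polynomials\<close>

text \<open>Re z^k and Im z^k are r^k cos(k \<theta>) and r^k sin(k \<theta>). The Cartesian form
  makes this a function of the point, independent of the choice of angle and visibly continuous at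
  the origin.\<close>

definition harm_poly :: "nat \<Rightarrow> (nat \<Rightarrow> real) \<Rightarrow> (nat \<Rightarrow> real) \<Rightarrow> real \<times> real \<Rightarrow> real" where
  "harm_poly K a b x =
     (\<Sum>k=0..K. a k * Re (Complex (fst x) (snd x) ^ k)) +
     (\<Sum>k=1..K. b k * Im (Complex (fst x) (snd x) ^ k))"

lemma harm_poly_polar:
  "harm_poly K a b (polar \<theta> r) =
     (\<Sum>k=0..K. a k * (r ^ k * cos (real k * \<theta>))) + (\<Sum>k=1..K. b k * (r ^ k * sin (real k * \<theta>)))"
proof -
  have "Complex (fst (polar \<theta> r)) (snd (polar \<theta> r)) = rcis r \<theta>"
    by (simp add: polar_def complex_eq_iff)
  then show ?thesis by (simp add: harm_poly_def DeMoivre2)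
qed

lemma harm_poly_circle:
  "harm_poly K a b (polar \<theta> 1) =
     (\<Sum>k=0..K. a k * cos (real k * \<theta>)) + (\<Sum>k=1..K. b k * sin (real k * \<theta>))"
  by (simp add: harm_poly_polar)

lemma continuous_on_harm_poly: "continuous_on S (harm_poly K a b)"
proof -
  have "harm_poly K a b = (\<lambda>x. (\<Sum>k=0..K. a k * Re ((of_real (fst x) + \<i> * of_real (snd x)) ^ k)) +
     (\<Sum>k=1..K. b k * Im ((of_real (fst x) + \<i> * of_real (snd x)) ^ k)))"
    by (simp add: fun_eq_iff harm_poly_def Complex_eq)
  then show ?thesis by (auto intro!: continuous_intros)
qed

lemma harm_poly_sum:
  "(\<Sum>j\<in>J. f j * harm_poly K (a j) (b j) x) =
     harm_poly K (\<lambda>k. \<Sum>j\<in>J. f j * a j k) (\<lambda>k. \<Sum>j\<in>J. f j * b j k) x"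
  unfolding harm_poly_def
  by (simp add: distrib_left sum.distrib sum_distrib_left sum_distrib_right mult.assoc)
     (subst (1 2) sum.swap, simp)

lemma harm_poly_diff:
  "harm_poly K a b x - harm_poly K a' b' x = harm_poly K (\<lambda>k. a k - a' k) (\<lambda>k. b k - b' k) x"
  by (simp add: harm_poly_def left_diff_distrib sum_subtractf)

lemma harm_poly_pad:
  assumes "K \<le> M"
  shows "harm_poly K a b x =
    harm_poly M (\<lambda>k. if k \<le> K then a k else 0) (\<lambda>k. if k \<le> K then b k else 0) x"
  unfolding harm_poly_def
  by (intro arg_cong2[where f = "(+)"] sum.mono_neutral_cong_left) (use assms in auto)

text \<open>Once the sine of frequency h is excluded, 2h coefficients face 2h nodes and
  orthogonality kills them all. The polynomial therefore vanishes on the whole plane, not just on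
  the circle.\<close>

lemma harm_poly_eq_zero:
  assumes "h > 0" and "b h = 0"
    and "\<And>l. l < 2*h \<Longrightarrow> harm_poly h a b (node (2*h) l) = 0"
  shows "harm_poly h a b x = 0"
proof -
  have *: "\<And>l. l < 2*h \<Longrightarrow>
      (\<Sum>k=0..h. a k * cos (real k * node_angle (2*h) l)) +
      (\<Sum>k=1..h. b k * sin (real k * node_angle (2*h) l)) = 0"
    using assms(3) by (simp add: node_def harm_poly_circle)
  have "a k = 0" if "k \<le> h" for k
    using trig_poly_coeffs_zero(1)[OF \<open>h > 0\<close> *] that by blast
  moreover have "b k = 0" if "0 < k" "k \<le> h" for k
    using trig_poly_coeffs_zero(2)[OF \<open>h > 0\<close> *, of k] that assms(2) by (cases "k = h") auto
  ultimately show ?thesis by (simp add: harm_poly_def)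
qed

text \<open>Provides the uniqueness behind the definite description in
  \<open>harmonic_extension\<close>. Finitely many nodes of a sufficiently fine grid suffice, so no
  Fourier integrals enter.\<close>

lemma harm_poly_determined_by_circle:
  assumes "\<And>\<theta>. harm_poly K a b (polar \<theta> 1) = harm_poly K' a' b' (polar \<theta> 1)"
  shows "harm_poly K a b x = harm_poly K' a' b' x"
proof -
  \<comment> \<open>One more than both degrees, so the padded sine coefficient at h is 0, as
    \<open>harm_poly_eq_zero\<close> demands.\<close>
  define h where "h = Suc (max K K')"
  define c where "c = (\<lambda>k. (if k \<le> K then a k else 0) - (if k \<le> K' then a' k else 0))"
  define d where "d = (\<lambda>k. (if k \<le> K then b k else 0) - (if k \<le> K' then b' k else 0))"
  have diff: "harm_poly K a b y - harm_poly K' a' b' y = harm_poly h c d y" for y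
    using harm_poly_pad[of K h a b y] harm_poly_pad[of K' h a' b' y]
    unfolding c_def d_def by (simp add: h_def harm_poly_diff)
  have "harm_poly h c d x = 0"
  proof (rule harm_poly_eq_zero)
    show "d h = 0" by (simp add: d_def h_def not_le less_Suc_eq_le)
    show "harm_poly h c d (node (2*h) l) = 0" for l
      using diff[of "node (2*h) l"] assms by (simp add: node_def)
  qed (simp add: h_def)
  then show ?thesis using diff[of x] by simp
qed


section \<open>Interpolation and harmonic extension\<close>

lemma closure_disc1: "closure disc1 = {polar \<theta> r |\<theta> r. 0 \<le> r \<and> r \<le> 1}" (is "_ = ?P")
  and frontier_disc1: "frontier disc1 = range (\<lambda>\<theta>. polar \<theta> 1)" (is "_ = ?F")
proof -
  have cl: "closure disc1 = {x. norm x \<le> 1}" and fr: "frontier disc1 = {x. norm x = 1}"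
    by (auto simp: disc1_def simp flip: zero_prod_def)
  have norm_polar: "norm (polar \<theta> r) = \<bar>r\<bar>" for \<theta> r
    by (simp add: polar_def norm_Pair power_mult_distrib flip: distrib_left)
  have ex: "\<exists>\<theta>. x = polar \<theta> (norm x)" for x
  proof -
    have "rcis (norm x) (Arg (Complex (fst x) (snd x))) = Complex (fst x) (snd x)"
      using rcis_cmod_Arg[of "Complex (fst x) (snd x)"]
      by (simp add: norm_prod_def cmod_def)
    then have "x = polar (Arg (Complex (fst x) (snd x))) (norm x)"
      by (simp add: complex_eq_iff polar_def prod_eq_iff)
    then show ?thesis by blast
  qed
  show "closure disc1 = ?P"
    unfolding cl using ex norm_polar by (fastforce intro: norm_ge_zero)
  show "frontier disc1 = ?F"
    unfolding fr using ex norm_polar by (auto, metis rangeI)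
qed

text \<open>A competitor may come with another degree and other coefficients, but its circle values
  are those of p, and these determine the polynomial on the whole disc.\<close>

lemma harmonic_extension_harm_poly:
  assumes "\<And>\<theta>. p (polar \<theta> 1) = harm_poly K a b (polar \<theta> 1)"
  shows "harmonic_extension p = restrict (harm_poly K a b) (closure disc1)"
  unfolding harmonic_extension_def
  unfolding harm_poly_circle[symmetric] harm_poly_polar[symmetric]
proof (rule the_equality)
  have "restrict (harm_poly K a b) (closure disc1) (polar \<theta> r) = harm_poly K a b (polar \<theta> r)"
    if "0 \<le> r \<and> r \<le> 1" for \<theta> r
    using that unfolding closure_disc1 by auto
  then show "restrict (harm_poly K a b) (closure disc1) \<in> extensional (closure disc1) \<and>
    (\<exists>K' a' b'. (\<forall>\<theta>. p (polar \<theta> 1) = harm_poly K' a' b' (polar \<theta> 1)) \<and>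
       (\<forall>\<theta> r. 0 \<le> r \<and> r \<le> 1 \<longrightarrow>
         restrict (harm_poly K a b) (closure disc1) (polar \<theta> r) = harm_poly K' a' b' (polar \<theta> r)))"
    using assms by auto
next
  fix u
  assume "u \<in> extensional (closure disc1) \<and>
    (\<exists>K' a' b'. (\<forall>\<theta>. p (polar \<theta> 1) = harm_poly K' a' b' (polar \<theta> 1)) \<and>
       (\<forall>\<theta> r. 0 \<le> r \<and> r \<le> 1 \<longrightarrow> u (polar \<theta> r) = harm_poly K' a' b' (polar \<theta> r)))"
  then obtain K' a' b' where u: "u \<in> extensional (closure disc1)"
    and p: "\<And>\<theta>. p (polar \<theta> 1) = harm_poly K' a' b' (polar \<theta> 1)"
    and ur: "\<And>\<theta> r. 0 \<le> r \<and> r \<le> 1 \<Longrightarrow> u (polar \<theta> r) = harm_poly K' a' b' (polar \<theta> r)"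
    by blast
  have eq: "harm_poly K' a' b' x = harm_poly K a b x" for x
    by (rule harm_poly_determined_by_circle) (simp flip: p add: assms)
  then show "u = restrict (harm_poly K a b) (closure disc1)"
    by (intro extensionalityI[OF u restrict_extensional]) (auto simp: closure_disc1 ur eq)
qed

text \<open>The weights are those of the trapezoidal rule, halved at the extreme frequencies
  \<open>0\<close> and \<open>n / 2\<close>; they make the kernel the Lagrange basis function of the \<open>j\<close>-th node.\<close>

definition lagrange :: "nat \<Rightarrow> nat \<Rightarrow> real \<times> real \<Rightarrow> real" where
  "lagrange n j = harm_poly (n div 2)
     (\<lambda>k. (if k = 0 \<or> k = n div 2 then 1 / real n else 2 / real n) * cos (real k * node_angle n j))
     (\<lambda>k. 2 / real n * sin (real k * node_angle n j))"

lemma sin_half_node_angle: "h > 0 \<Longrightarrow> sin (real h * node_angle (2*h) l) = 0"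
  by (simp add: node_angle_def sin_npi)

lemma sum_split_ends:
  fixes f :: "nat \<Rightarrow> 'a::comm_monoid_add"
  assumes "h > 0"
  shows "(\<Sum>k=0..h. f k) = f 0 + (\<Sum>k=1..<h. f k) + f h"
  using assms by (simp add: atLeast0AtMost sum.head sum.atLeast_Suc_atMost
      sum.last_plus[of 0 h] atLeastLessThanSuc_atLeastAtMost[symmetric]) (simp add: sum.atLeast_Suc_lessThan add_ac)

text \<open>The addition theorem turns the kernel into a trapezoidal sum of cos(k(x_l - x_j)) for k
  from 0 to h. Reflecting k to 2h - k unfolds it into a full sum over 2h nodes, which is 2h or
  0.\<close>

lemma lagrange_node:
  assumes "h > 0" "j < 2*h" "l < 2*h"
  shows "lagrange (2*h) j (node (2*h) l) = (if j = l then 1 else 0)"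
proof -
  let ?x = "node_angle (2*h)"
  define d where "d = int l - int j"
  \<comment> \<open>Node and frequency swap roles: k(x_l - x_j) = (l - j) x_k, so k becomes the node
    index and \<open>sum_cos_nodes\<close> applies with frequency d.\<close>
  define C where "C = (\<lambda>k::nat. cos (of_int d * ?x k))"
  have C: "C k = cos (real k * ?x j) * cos (real k * ?x l) + sin (real k * ?x j) * sin (real k * ?x l)"
    for k
  proof -
    have "of_int d * ?x k = real k * ?x l - real k * ?x j"
      by (simp add: d_def node_angle_def algebra_simps diff_divide_distrib)
    then show ?thesis by (simp add: C_def cos_diff)
  qed
  have reflect: "(\<Sum>k=Suc h..<2*h. C k) = (\<Sum>k=1..<h. C k)"
  proof -
    have "C (2*h - k) = C k" if "k < 2*h" for k
    proof -
      have "of_int d * ?x (2*h - k) = 2 * pi * of_int d - of_int d * ?x k"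
        using that \<open>h > 0\<close> by (simp add: node_angle_def of_nat_diff field_simps)
      then show ?thesis by (simp add: C_def cos_diff)
    qed
    then show ?thesis
      by (intro sum.reindex_bij_witness[of _ "\<lambda>k. 2*h - k" "\<lambda>k. 2*h - k"]) auto
  qed
  have "lagrange (2*h) j (node (2*h) l) =
      (\<Sum>k=0..h. (if k = 0 \<or> k = h then 1 / real (2*h) else 2 / real (2*h)) *
         cos (real k * ?x j) * cos (real k * ?x l)) +
      (\<Sum>k=0..h. 2 / real (2*h) * sin (real k * ?x j) * sin (real k * ?x l))"
    by (simp add: lagrange_def node_def harm_poly_circle sum.atLeast_Suc_atMost[of 0 h])
  \<comment> \<open>The weights of the cosine and sine sums differ only at k = 0 and k = h, where
    the sines vanish.\<close>
  also have "\<dots> = (\<Sum>k=0..h. (if k = 0 \<or> k = h then 1 / real (2*h) else 2 / real (2*h)) * C k)"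
    unfolding sum.distrib[symmetric]
    by (intro sum.cong refl) (auto simp: C sin_half_node_angle[OF \<open>h > 0\<close>] distrib_left)
  also have "\<dots> = (C 0 + 2 * (\<Sum>k=1..<h. C k) + C h) / real (2*h)"
    using \<open>h > 0\<close> by (simp add: sum_split_ends add_divide_distrib flip: sum_divide_distrib sum_distrib_left)
  also have "C 0 + 2 * (\<Sum>k=1..<h. C k) + C h = (\<Sum>k<2*h. C k)"
  proof -
    have "(\<Sum>k<2*h. C k) = (\<Sum>k=0..<h. C k) + (\<Sum>k=h..<2*h. C k)"
      by (simp add: lessThan_atLeast0 sum.atLeastLessThan_concat)
    also have "\<dots> = C 0 + (\<Sum>k=1..<h. C k) + (C h + (\<Sum>k=Suc h..<2*h. C k))"
      using \<open>h > 0\<close> by (simp add: sum.atLeast_Suc_lessThan)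
    finally show ?thesis using reflect by simp
  qed
  also have "\<dots> = (if int (2*h) dvd d then real (2*h) else 0)"
    unfolding C_def using \<open>h > 0\<close> by (intro sum_cos_nodes) simp
  also have "int (2*h) dvd d \<longleftrightarrow> j = l"
    using not_dvd_of_abs_less[of d "2*h"] assms by (cases "j = l") (auto simp: d_def)
  finally show ?thesis using \<open>h > 0\<close> by simp
qed

text \<open>Existence comes from the Lagrange functions; uniqueness holds because the difference of
  two interpolants vanishes at all 2h nodes and has no sine of frequency h.\<close>

lemma trig_interpolant_eq:
  assumes "h > 0"
  shows "trig_interpolant (h - 1) (2*h) f =
    restrict (\<lambda>x. \<Sum>j<2*h. f (node (2*h) j) * lagrange (2*h) j x) (frontier disc1)"
proof -
  \<comment> \<open>The extra term cos(n/2 \<theta>) becomes the cosine coefficient at h, and the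
    sine coefficient there is set to 0.\<close>
  have poly: "(\<Sum>k=0..h-1. a k * cos (real k * \<theta>)) + (\<Sum>k=1..h-1. b k * sin (real k * \<theta>))
          + c * cos (real (2*h) / 2 * \<theta>) = harm_poly h (a(h := c)) (b(h := 0)) (polar \<theta> 1)" for a b c \<theta>
  proof -
    obtain m where h: "h = Suc m" using assms gr0_implies_Suc by blast
    have half: "real (2 * Suc m) / 2 = real (Suc m)" by simp
    show ?thesis unfolding harm_poly_circle h half by simp
  qed
  define g where "g = (\<lambda>x. \<Sum>j<2*h. f (node (2*h) j) * lagrange (2*h) j x)"
  define A where "A = (\<lambda>k. \<Sum>j<2*h. f (node (2*h) j) *
    ((if k = 0 \<or> k = 2*h div 2 then 1 / real (2*h) else 2 / real (2*h)) * cos (real k * node_angle (2*h) j)))"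
  define B where "B = (\<lambda>k. \<Sum>j<2*h. f (node (2*h) j) * (2 / real (2*h) * sin (real k * node_angle (2*h) j)))"
  have Bh: "B h = 0"
    by (simp only: B_def sin_half_node_angle[OF assms]) simp
  have g: "g x = harm_poly h A B x" for x
    unfolding g_def lagrange_def harm_poly_sum A_def B_def by simp
  have g_node: "g (node (2*h) l) = f (node (2*h) l)" if "l < 2*h" for l
    using that by (simp add: g_def lagrange_node[OF assms] if_distrib[of "(*) _"] cong: if_cong)
  have circle: "polar \<theta> 1 \<in> frontier disc1" for \<theta>
    by (simp add: frontier_disc1)
  have "(THE p. p \<in> trig_space (h - 1) (2*h) \<and> (\<forall>l<2*h. p (node (2*h) l) = f (node (2*h) l)))
      = restrict g (frontier disc1)"
  proof (rule the_equality)
    have "\<exists>a b c. \<forall>\<theta>. g (polar \<theta> 1) = harm_poly h (a(h := c)) (b(h := 0)) (polar \<theta> 1)"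
      \<comment> \<open>Overwriting A at h by \<open>A h\<close>, and B at h by 0, changes nothing,
        the latter by \<open>Bh\<close>.\<close>
      by (rule exI[of _ A], rule exI[of _ B], rule exI[of _ "A h"]) (simp add: g flip: Bh)
    then show "restrict g (frontier disc1) \<in> trig_space (h - 1) (2*h) \<and>
        (\<forall>l<2*h. restrict g (frontier disc1) (node (2*h) l) = f (node (2*h) l))"
      unfolding trig_space_def poly using circle g_node by (simp add: node_def)
  next
    fix p
    assume "p \<in> trig_space (h - 1) (2*h) \<and> (\<forall>l<2*h. p (node (2*h) l) = f (node (2*h) l))"
    then obtain a b c where ext: "p \<in> extensional (frontier disc1)"
      and p: "\<And>\<theta>. p (polar \<theta> 1) = harm_poly h (a(h := c)) (b(h := 0)) (polar \<theta> 1)"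
      and p_node: "\<And>l. l < 2*h \<Longrightarrow> p (node (2*h) l) = f (node (2*h) l)"
      unfolding trig_space_def poly by blast
    have "p (polar \<theta> 1) = g (polar \<theta> 1)" for \<theta>
    proof -
      have "harm_poly h (a(h := c)) (b(h := 0)) x - harm_poly h A B x = 0" for x
        unfolding harm_poly_diff
      proof (rule harm_poly_eq_zero[OF assms])
        show "(b(h := 0)) h - B h = 0" by (simp add: Bh)
        show "harm_poly h (\<lambda>k. (a(h := c)) k - A k) (\<lambda>k. (b(h := 0)) k - B k) (node (2*h) l) = 0"
          if "l < 2*h" for l
          using p_node[OF that] g_node[OF that] p
          unfolding harm_poly_diff[symmetric] g by (simp add: node_def del: fun_upd_apply)
      qed
      then show ?thesis by (simp add: p g)
    qed
    then show "p = restrict g (frontier disc1)"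
      by (intro extensionalityI[OF ext restrict_extensional]) (auto simp: frontier_disc1)
  qed
  then show ?thesis unfolding trig_interpolant_def g_def .
qed

text \<open>The interpolant is a \<open>harm_poly\<close> on the circle, and its harmonic extension
  is the same \<open>harm_poly\<close> on the closed disc, which contains the closed second
  arc.\<close>

lemma L_op_eq:
  assumes "h > 0" and "x \<in> closure (arc2 \<theta>1 \<theta>2)"
  shows "L_op (h - 1) (2*h) \<theta>1 \<theta>2 v x =
    (\<Sum>j<2*h. zero_extension (arc1 \<theta>1 \<theta>2) v (node (2*h) j) * lagrange (2*h) j x)"
proof -
  let ?f = "zero_extension (arc1 \<theta>1 \<theta>2) v"
  have "x \<in> closure disc1"
    using assms(2) closure_mono[of "arc2 \<theta>1 \<theta>2" disc1] by (auto simp: arc2_def)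
  moreover have "harmonic_extension (trig_interpolant (h - 1) (2*h) ?f) =
      restrict (\<lambda>x. \<Sum>j<2*h. ?f (node (2*h) j) * lagrange (2*h) j x) (closure disc1)"
    unfolding trig_interpolant_eq[OF assms(1)] lagrange_def harm_poly_sum
    by (rule harmonic_extension_harm_poly) (simp add: frontier_disc1)
  ultimately show ?thesis using assms(2) by (simp add: L_op_def)
qed


section \<open>The bound\<close>

text \<open>The halves in the first and last entries of \<open>c_vec\<close>, times the factor 2/n
  of \<open>C_mat\<close>, give exactly the end weights 1/n of \<open>lagrange\<close>.\<close>

lemma vec_index_lagrange:
  assumes "h > 0" "j < 2*h"
  shows "vec_index (C_mat (2*h) *\<^sub>v c_vec (2*h) \<theta> r + S_mat (2*h) *\<^sub>v s_vec (2*h) \<theta> r) j =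
    lagrange (2*h) j (polar \<theta> r)"
proof -
  let ?x = "node_angle (2*h) j"
  have "vec_index (C_mat (2*h) *\<^sub>v c_vec (2*h) \<theta> r) j =
      (\<Sum>k=0..h. (if k = 0 \<or> k = h then 1 / real (2*h) else 2 / real (2*h)) *
        cos (real k * ?x) * (r ^ k * cos (real k * \<theta>)))"
    using assms
    by (auto simp: C_mat_def c_vec_def scalar_prod_def atLeastLessThanSuc_atLeastAtMost intro!: sum.cong)
  moreover have "vec_index (S_mat (2*h) *\<^sub>v s_vec (2*h) \<theta> r) j =
      (\<Sum>k=1..h. 2 / real (2*h) * sin (real k * ?x) * (r ^ k * sin (real k * \<theta>)))"
  proof -
    obtain m where h: "h = Suc m" using assms gr0_implies_Suc by blast
    have "vec_index (S_mat (2*h) *\<^sub>v s_vec (2*h) \<theta> r) j =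
        (\<Sum>k<m. 2 / real (2*h) * sin (real (Suc k) * ?x) * (r ^ Suc k * sin (real (Suc k) * \<theta>)))"
      using assms h by (auto simp: S_mat_def s_vec_def scalar_prod_def lessThan_atLeast0 intro!: sum.cong)
    also have "\<dots> = (\<Sum>k=1..m. 2 / real (2*h) * sin (real k * ?x) * (r ^ k * sin (real k * \<theta>)))"
      by (rule sum.reindex_bij_witness[of _ "\<lambda>k. k - 1" Suc]) auto
    \<comment> \<open>\<open>S_mat\<close> has only h - 1 columns; the term k = h is added freely,
      since sin(h x_j) = 0.\<close>
    also have "\<dots> = (\<Sum>k=1..h. 2 / real (2*h) * sin (real k * ?x) * (r ^ k * sin (real k * \<theta>)))"
      using sin_half_node_angle[OF assms(1), of j] unfolding h by simp
    finally show ?thesis .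
  qed
  moreover have "dim_vec (C_mat (2*h) *\<^sub>v c_vec (2*h) \<theta> r) = 2*h"
    "dim_vec (S_mat (2*h) *\<^sub>v s_vec (2*h) \<theta> r) = 2*h"
    by (simp_all add: C_mat_def S_mat_def)
  ultimately show ?thesis
    using assms by (simp add: lagrange_def harm_poly_polar)
qed

text \<open>Makes the bound a function of the point alone. The parameter set
  \<open>arc2_polar\<close> is unbounded in the angle, so compactness has to be used on the arc
  itself.\<close>

lemma Q_bound_eq:
  assumes "h > 0"
  shows "Q_bound (2*h) \<theta>1 \<theta>2 \<theta> r =
    (\<Sum>j<2*h. if node (2*h) j \<in> arc1 \<theta>1 \<theta>2 then \<bar>lagrange (2*h) j (polar \<theta> r)\<bar> else 0)"
  unfolding Q_bound_def norm_l1_def Q_proj_def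
  by (auto intro!: sum.cong simp: vec_index_lagrange[OF assms])

text \<open>The leftmost point (m - R, 0) of the second circle lies in the unit disc: (m - R)^2 <
  m^2 + R^2 + 2mR cos \<theta>2 = 1, because m, R > 0 and cos \<theta>2 > -1.\<close>

lemma arc2_nonempty:
  assumes "0 < \<theta>1" "\<theta>1 < \<theta>2" "\<theta>2 < pi"
  shows "arc2 \<theta>1 \<theta>2 \<noteq> {}"
proof -
  define m where "m = centre2 \<theta>1 \<theta>2"
  define R where "R = radius2 \<theta>1 \<theta>2"
  have s1: "sin \<theta>1 > 0" and s2: "sin \<theta>2 > 0" and sd: "sin (\<theta>2 - \<theta>1) > 0"
    using assms by (auto intro!: sin_gt_zero)
  have R: "R > 0" using s1 s2 by (simp add: R_def radius2_def)
  have m_eq: "m = cos \<theta>1 - R * cos \<theta>2"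
    by (cases "\<theta>2 = pi / 2") (simp_all add: m_def centre2_def R_def radius2_def tan_def del: eq_divide_eq_numeral1)
  also have "\<dots> = sin (\<theta>2 - \<theta>1) / sin \<theta>2"
    using s2 by (simp add: R_def radius2_def sin_diff field_simps)
  finally have m: "m > 0" using sd s2 by simp
  have "cos \<theta>2 > cos pi" using assms by (intro cos_monotone_0_pi) auto
  then have "m * R * cos \<theta>2 > m * R * (-1)" using m R by (intro mult_strict_left_mono) auto
  \<comment> \<open>The intersection point (m + R cos \<theta>2, R sin \<theta>2) = (cos \<theta>1,
    sin \<theta>1) lies on the unit circle.\<close>
  moreover have "m\<^sup>2 + R\<^sup>2 + 2 * (m * R * cos \<theta>2) = 1"
  proof -
    have "cos \<theta>1 = m + R * cos \<theta>2" "sin \<theta>1 = R * sin \<theta>2"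
      using m_eq s2 by (auto simp: R_def radius2_def)
    then have "(m + R * cos \<theta>2)\<^sup>2 + R\<^sup>2 * (1 - (cos \<theta>2)\<^sup>2) = 1"
      using sin_cos_squared_add2[of \<theta>1] by (simp add: power_mult_distrib sin_squared_eq)
    then show ?thesis by (simp add: power2_eq_square algebra_simps)
  qed
  ultimately have "(m - R)\<^sup>2 < 1" by (simp add: power2_diff)
  then have "\<bar>m - R\<bar> < 1" by (simp add: abs_square_less_1)
  then have "(m - R, 0) \<in> arc2 \<theta>1 \<theta>2"
    using R unfolding arc2_def disc1_def disc2_def m_def[symmetric] R_def[symmetric]
    by (simp add: dist_prod_def dist_real_def)
  then show ?thesis by blast
qed

lemma sup_norm_L_op_le:
  assumes "h > 0" and "\<And>x. x \<in> arc1 \<theta>1 \<theta>2 \<Longrightarrow> \<bar>v x\<bar> \<le> s" and "s \<ge> 0"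
    and "\<And>\<theta> r. (\<theta>, r) \<in> arc2_polar \<theta>1 \<theta>2 \<Longrightarrow> Q_bound (2*h) \<theta>1 \<theta>2 \<theta> r \<le> q"
  shows "sup_norm (closure (arc2 \<theta>1 \<theta>2)) (L_op (h - 1) (2*h) \<theta>1 \<theta>2 v) \<le> ereal (q * s)"
  unfolding sup_norm_def
proof (rule SUP_least)
  fix x assume x: "x \<in> closure (arc2 \<theta>1 \<theta>2)"
  then have "x \<in> closure disc1"
    using closure_mono[of "arc2 \<theta>1 \<theta>2" disc1] by (auto simp: arc2_def)
  then obtain \<theta> r where x_eq: "x = polar \<theta> r" and r: "0 \<le> r" "r \<le> 1"
    by (auto simp: closure_disc1)
  have "\<bar>L_op (h - 1) (2*h) \<theta>1 \<theta>2 v x\<bar> \<le>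
      (\<Sum>j<2*h. \<bar>zero_extension (arc1 \<theta>1 \<theta>2) v (node (2*h) j) * lagrange (2*h) j x\<bar>)"
    unfolding L_op_eq[OF assms(1) x] by (rule sum_abs)
  \<comment> \<open>The extension by zero drops the nodes outside the open first arc, which is the
    effect of Q.\<close>
  also have "\<dots> \<le> (\<Sum>j<2*h. (if node (2*h) j \<in> arc1 \<theta>1 \<theta>2 then \<bar>lagrange (2*h) j x\<bar> else 0) * s)"
    by (intro sum_mono)
       (auto simp: zero_extension_def abs_mult mult.commute[of _ s] intro!: mult_right_mono assms(2))
  also have "\<dots> = Q_bound (2*h) \<theta>1 \<theta>2 \<theta> r * s"
    by (simp only: Q_bound_eq[OF assms(1)] x_eq sum_distrib_right)
  also have "\<dots> \<le> q * s"
    using assms(3,4) x r by (intro mult_right_mono) (auto simp: arc2_polar_def x_eq)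
  finally show "ereal \<bar>L_op (h - 1) (2*h) \<theta>1 \<theta>2 v x\<bar> \<le> ereal (q * s)" by simp
qed

theorem mainTheorem4:
  fixes n1 n2 N :: nat and \<theta>1 \<theta>2 :: real
  assumes "even n1" and "n1 > 0" and "even n2" and "n2 > 0"
    and "0 < \<theta>1" and "\<theta>1 < \<theta>2" and "\<theta>2 < pi"
    and "\<exists>k::int. \<theta>1 = of_int k * (2 * pi / real n1)"
    and "\<exists>k::int. \<theta>2 = of_int k * (2 * pi / real n2)"
    and "N = n1 div 2 - 1"
  shows "\<exists>(\<theta>, r) \<in> arc2_polar \<theta>1 \<theta>2.
           (\<forall>(\<theta>', r') \<in> arc2_polar \<theta>1 \<theta>2. Q_bound n1 \<theta>1 \<theta>2 \<theta>' r' \<le> Q_bound n1 \<theta>1 \<theta>2 \<theta> r) \<and>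
           L_op_norm N n1 \<theta>1 \<theta>2 \<le> ereal (Q_bound n1 \<theta>1 \<theta>2 \<theta> r)"
proof -
  obtain h where n1: "n1 = 2*h" using \<open>even n1\<close> by blast
  have h: "h > 0" and N: "N = h - 1" using assms n1 by auto
  define G where "G = (\<lambda>x. \<Sum>j<2*h. if node (2*h) j \<in> arc1 \<theta>1 \<theta>2 then \<bar>lagrange (2*h) j x\<bar> else 0)"
  have QG: "Q_bound n1 \<theta>1 \<theta>2 \<theta> r = G (polar \<theta> r)" for \<theta> r
    by (simp add: n1 G_def Q_bound_eq[OF h])
  have sub: "closure (arc2 \<theta>1 \<theta>2) \<subseteq> closure disc1"
    by (intro closure_mono) (auto simp: arc2_def)
  have "compact (closure (arc2 \<theta>1 \<theta>2))"
    using bounded_subset[of disc1 "arc2 \<theta>1 \<theta>2"] by (auto simp: arc2_def disc1_def)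
  moreover have "closure (arc2 \<theta>1 \<theta>2) \<noteq> {}"
    using arc2_nonempty assms by simp
  moreover have "continuous_on (closure (arc2 \<theta>1 \<theta>2)) G"
  proof -
    have "continuous_on S (\<lambda>x. if P then \<bar>lagrange (2*h) j x\<bar> else 0)" for S P j
      unfolding lagrange_def by (cases P) (auto intro!: continuous_intros continuous_on_harm_poly)
    then show ?thesis unfolding G_def by (intro continuous_on_sum)
  qed
  ultimately obtain x where x: "x \<in> closure (arc2 \<theta>1 \<theta>2)"
    and max: "\<And>y. y \<in> closure (arc2 \<theta>1 \<theta>2) \<Longrightarrow> G y \<le> G x"
    using continuous_attains_sup by metis
  obtain \<theta> r where x_eq: "x = polar \<theta> r" and r: "0 \<le> r" "r \<le> 1"
    using x sub by (auto simp: closure_disc1)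
  have mem: "(\<theta>, r) \<in> arc2_polar \<theta>1 \<theta>2"
    using x r by (simp add: arc2_polar_def x_eq)
  have bound: "Q_bound n1 \<theta>1 \<theta>2 \<theta>' r' \<le> Q_bound n1 \<theta>1 \<theta>2 \<theta> r"
    if "(\<theta>', r') \<in> arc2_polar \<theta>1 \<theta>2" for \<theta>' r'
    using that max by (auto simp: arc2_polar_def QG x_eq)
  define q where "q = Q_bound n1 \<theta>1 \<theta>2 \<theta> r"
  have q0: "q \<ge> 0"
    unfolding q_def QG G_def by (intro sum_nonneg) auto
  have "L_op_norm N n1 \<theta>1 \<theta>2 \<le> ereal q"
    unfolding L_op_norm_def
  proof (rule SUP_least)
    fix v
    let ?L = "sup_norm (closure (arc2 \<theta>1 \<theta>2)) (L_op N n1 \<theta>1 \<theta>2 v)"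
    show "?L / sup_norm (arc1 \<theta>1 \<theta>2) v \<le> ereal q"
    \<comment> \<open>The norm is extended-real, so the infinite values must be treated as
      well.\<close>
    proof (cases "sup_norm (arc1 \<theta>1 \<theta>2) v")
      case (real s)
      have vs: "\<bar>v y\<bar> \<le> s" if "y \<in> arc1 \<theta>1 \<theta>2" for y
        using SUP_upper[OF that, of "\<lambda>y. ereal \<bar>v y\<bar>"] real by (simp add: sup_norm_def)
      \<comment> \<open>A supremum over the empty set would be minus infinity, not a real s.\<close>
      have "arc1 \<theta>1 \<theta>2 \<noteq> {}"
        using real by (auto simp: sup_norm_def bot_ereal_def)
      then have s0: "s \<ge> 0" using vs by fastforce
      have L: "?L \<le> ereal (q * s)"
        unfolding n1 N using bound
        by (intro sup_norm_L_op_le[OF h vs s0]) (auto simp: n1 q_def)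
      have "?L / ereal s \<le> ereal q"
      \<comment> \<open>For s = 0 the numerator is squeezed to 0, and 0 / 0 = 0 in the extended
        reals.\<close>
      proof (cases "s = 0")
        case True
        have "?L \<ge> 0"
          unfolding sup_norm_def by (rule SUP_upper2[OF x]) simp
        then have "?L = 0" using L True by (simp add: zero_ereal_def)
        then show ?thesis using q0 by simp
      next
        case False
        then show ?thesis
          using L s0 by (simp add: ereal_divide_le_pos mult.commute)
      qed
      then show ?thesis using real by simp
    \<comment> \<open>Division by plus or minus infinity gives 0, which is at most q.\<close>
    qed (use q0 in auto)
  qed
  then show ?thesis
    using mem bound unfolding q_def by blast
qed

end
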